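(* Let $G$ be a framework for a $3$-connected matroid $M$ with $|E(M)|\ge 4$, and let $e$ be a loop-edge of $G$ at a vertex $v$. If $e\notin \mathrm{cl}_M(E(G-v))$, then the independent sets of $M$ are exactly the sets $I\subseteq E(G)$ such that $G[I]$ contains no balanced cycle and $|E(H)|\le |V(H)|$ for each component $H$ of $G[I]$.
   Context: For a graph $G$ and a vertex $v$, $\mathrm{loops}_G(v)$ denotes the set of loop-edges of $G$ at $v$. Graphs are finite and may have loops and parallel edges; a loop-edge forms a cycle of length one. For a set $X$ of edges, $G[X]$ is the subgraph of $G$ with edge-set $X$ and no isolated vertices. A graph $G$ is a framework for a matroid $M$ if (1) $E(G)=E(M)$; (2) $r_M(E(H))\le |V(H)|$ for each component $H$ of $G$; (3) for each vertex $v$ of $G$, $\mathrm{cl}_M(E(G-v))\subseteq E(G-v)\cup \mathrm{loops}_G(v)$; and (4) for each circuit $C$ of $M$, the subgraph $G[C]$ has at most two components. A cycle $C$ of $G$ is balanced (with respect to $M$) if $E(C)$ is a circuit of $M$. *)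

theory Defs
  imports Main
begin

section \<open>Matroids\<close>

record 'e pre_matroid =
  ground :: "'e set"
  indep_sets :: "'e set set"

locale matroid =
  fixes M :: "'e pre_matroid" (structure)
  assumes finite_ground: "finite (ground M)"
    and indep_subset_ground: "I \<in> indep_sets M \<Longrightarrow> I \<subseteq> ground M"
    and indep_empty: "{} \<in> indep_sets M"
    and indep_subset: "\<lbrakk>I \<in> indep_sets M; J \<subseteq> I\<rbrakk> \<Longrightarrow> J \<in> indep_sets M"
    and indep_augment: "\<lbrakk>I \<in> indep_sets M; J \<in> indep_sets M; card I < card J\<rbrakk>
      \<Longrightarrow> \<exists>x \<in> J - I. insert x I \<in> indep_sets M"

definition circuit :: "'e pre_matroid \<Rightarrow> 'e set \<Rightarrow> bool" where
  "circuit M C \<longleftrightarrow> C \<subseteq> ground M \<and> C \<notin> indep_sets M \<and> (\<forall>D. D \<subset> C \<longrightarrow> D \<in> indep_sets M)"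

definition rank :: "'e pre_matroid \<Rightarrow> 'e set \<Rightarrow> nat" where
  "rank M X = Max (card ` {I \<in> indep_sets M. I \<subseteq> X})"

definition cl :: "'e pre_matroid \<Rightarrow> 'e set \<Rightarrow> 'e set" where
  "cl M X = {x \<in> ground M. rank M (insert x X) = rank M X}"

text \<open>
  A \<open>k\<close>-separation is a partition \<open>(X, Y)\<close> of the ground set into parts of size at least \<open>k\<close>
  with connectivity \<open>r(X) + r(Y) - r(M) < k\<close>; the inequality is rearranged because subtraction
  of natural numbers truncates.
\<close>

definition separation :: "'e pre_matroid \<Rightarrow> nat \<Rightarrow> 'e set \<Rightarrow> 'e set \<Rightarrow> bool" where
  "separation M k X Y \<longleftrightarrow>
     X \<union> Y = ground M \<and> X \<inter> Y = {} \<and> k \<le> card X \<and> k \<le> card Y \<and>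
     rank M X + rank M Y < rank M (ground M) + k"

definition matroid_connected :: "nat \<Rightarrow> 'e pre_matroid \<Rightarrow> bool" where
  "matroid_connected n M \<longleftrightarrow> (\<forall>k X Y. 1 \<le> k \<and> k < n \<longrightarrow> \<not> separation M k X Y)"

section \<open>Graphs with loops and parallel edges\<close>

text \<open>The ends of an edge form a two-element set, or a singleton if the edge is a loop.\<close>

record ('v, 'e) pre_multigraph =
  verts :: "'v set"
  edges :: "'e set"
  ends :: "'e \<Rightarrow> 'v set"

definition multigraph :: "('v, 'e) pre_multigraph \<Rightarrow> bool" where
  "multigraph G \<longleftrightarrow> finite (verts G) \<and> finite (edges G) \<and>
     (\<forall>e \<in> edges G. ends G e \<subseteq> verts G \<and> card (ends G e) \<in> {1, 2})"

definition loops :: "('v, 'e) pre_multigraph \<Rightarrow> 'v \<Rightarrow> 'e set" where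
  "loops G v = {e \<in> edges G. ends G e = {v}}"

text \<open>
  Subgraphs carry the same total function \<open>ends\<close>, so that a subgraph is determined by its
  vertices and edges and sets of subgraphs can be counted.
\<close>

definition subgraph :: "('v, 'e) pre_multigraph \<Rightarrow> ('v, 'e) pre_multigraph \<Rightarrow> bool" where
  "subgraph H G \<longleftrightarrow> multigraph H \<and> multigraph G \<and>
     verts H \<subseteq> verts G \<and> edges H \<subseteq> edges G \<and> ends H = ends G"

definition edge_subgraph :: "('v, 'e) pre_multigraph \<Rightarrow> 'e set \<Rightarrow> ('v, 'e) pre_multigraph" where
  "edge_subgraph G X = \<lparr>verts = \<Union> (ends G ` X), edges = X, ends = ends G\<rparr>"

definition delete_vertex :: "('v, 'e) pre_multigraph \<Rightarrow> 'v \<Rightarrow> ('v, 'e) pre_multigraph" where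
  "delete_vertex G v =
     \<lparr>verts = verts G - {v}, edges = {e \<in> edges G. v \<notin> ends G e}, ends = ends G\<rparr>"

definition adjacency :: "('v, 'e) pre_multigraph \<Rightarrow> ('v \<times> 'v) set" where
  "adjacency G = {(u, w). \<exists>e \<in> edges G. ends G e = {u, w}}"

definition connected :: "('v, 'e) pre_multigraph \<Rightarrow> bool" where
  "connected G \<longleftrightarrow> verts G \<noteq> {} \<and> (\<forall>u \<in> verts G. \<forall>w \<in> verts G. (u, w) \<in> (adjacency G)\<^sup>*)"

definition components :: "('v, 'e) pre_multigraph \<Rightarrow> ('v, 'e) pre_multigraph set" where
  "components G = {H. subgraph H G \<and> connected H \<and>
     (\<forall>H'. subgraph H' G \<and> connected H' \<and> subgraph H H' \<longrightarrow> H' = H)}"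

text \<open>A loop contributes two to the degree of its vertex.\<close>

definition degree :: "('v, 'e) pre_multigraph \<Rightarrow> 'v \<Rightarrow> nat" where
  "degree G v = card {e \<in> edges G. v \<in> ends G e} + card (loops G v)"

text \<open>
  A cycle is a connected 2-regular subgraph. A loop with its vertex is a cycle of length one,
  and two parallel edges with their ends form a cycle of length two.
\<close>

definition cycle :: "('v, 'e) pre_multigraph \<Rightarrow> ('v, 'e) pre_multigraph \<Rightarrow> bool" where
  "cycle G C \<longleftrightarrow> subgraph C G \<and> connected C \<and> (\<forall>v \<in> verts C. degree C v = 2)"

section \<open>Frameworks\<close>

definition framework :: "('v, 'e) pre_multigraph \<Rightarrow> 'e pre_matroid \<Rightarrow> bool" where
  "framework G M \<longleftrightarrow>
     multigraph G \<and>
     edges G = ground M \<and>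
     (\<forall>H \<in> components G. rank M (edges H) \<le> card (verts H)) \<and>
     (\<forall>v \<in> verts G. cl M (edges (delete_vertex G v)) \<subseteq> edges (delete_vertex G v) \<union> loops G v) \<and>
     (\<forall>C. circuit M C \<longrightarrow> card (components (edge_subgraph G C)) \<le> 2)"

definition balanced_cycle ::
  "'e pre_matroid \<Rightarrow> ('v, 'e) pre_multigraph \<Rightarrow> ('v, 'e) pre_multigraph \<Rightarrow> bool" where
  "balanced_cycle M G C \<longleftrightarrow> cycle G C \<and> circuit M (edges C)"

end

theory Submission
  imports Defs
begin

text \<open>
  Growing a vertex set \<open>U\<close> one vertex at a time along edges raises the rank of the set of edges
  spanned by \<open>U\<close> by at least one at every step, even in the presence of a set \<open>Y\<close> of edges
  avoiding all these vertices. Growing \<open>U\<close> to a whole component gives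
  \<open>r(E(U)) \<le> |U|\<close> for connected \<open>U\<close>. If \<open>v \<in> U\<close>, growing from \<open>v\<close>, where the loop \<open>e\<close> supplies
  one more unit of rank, gives \<open>r(E(U) \<union> Y) \<ge> |U| + r(Y)\<close>. Hence \<open>E(U)\<close> and \<open>Y\<close> are skew and no
  circuit inside \<open>E(U) \<union> Y\<close> meets both. Taking for \<open>U\<close> a path from \<open>v\<close> to a circuit \<open>C\<close> together
  with the component of \<open>G[C]\<close> it reaches shows that \<open>G[C]\<close> is connected; without such a path the
  component of \<open>v\<close> would give a 1-separation. As all degrees of \<open>G[C]\<close> are at least two, it is
  a balanced cycle or has more edges than vertices.
\<close>

section \<open>Rank in matroids\<close>

context matroid
begin

lemma finite_indep: "I \<in> indep_sets M \<Longrightarrow> finite I"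
  using indep_subset_ground finite_ground finite_subset by blast

lemma finite_indep_sets: "finite (indep_sets M)"
  by (rule finite_subset[of _ "Pow (ground M)"]) (use indep_subset_ground finite_ground in auto)

lemma card_le_rank: "\<lbrakk>I \<in> indep_sets M; I \<subseteq> X\<rbrakk> \<Longrightarrow> card I \<le> rank M X"
  unfolding rank_def using finite_indep_sets by (intro Max_ge) auto

text \<open>As long as \<open>I\<close> is smaller than a largest independent subset
  \<open>B\<close> of \<open>X\<close>, augmentation from \<open>B\<close> enlarges it inside
  \<open>X\<close>.\<close>

lemma obtain_basis:
  assumes "I \<in> indep_sets M" "I \<subseteq> X"
  obtains J where "J \<in> indep_sets M" "I \<subseteq> J" "J \<subseteq> X" "card J = rank M X"
proof -
  have "rank M X \<in> card ` {I \<in> indep_sets M. I \<subseteq> X}"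
    unfolding rank_def using finite_indep_sets indep_empty by (intro Max_in) auto
  then obtain B where B: "B \<in> indep_sets M" "B \<subseteq> X" "card B = rank M X" by auto
  have "\<exists>J. J \<in> indep_sets M \<and> I \<subseteq> J \<and> J \<subseteq> X \<and> card J = rank M X"
    using assms
  proof (induction "rank M X - card I" arbitrary: I rule: less_induct)
    case less
    show ?case
    proof (cases "card I < rank M X")
      case True
      then obtain x where x: "x \<in> B - I" "insert x I \<in> indep_sets M"
        using indep_augment[OF less.prems(1) B(1)] B(3) by auto
      then have "card (insert x I) = Suc (card I)" using finite_indep[OF less.prems(1)] by simp
      with True have "rank M X - card (insert x I) < rank M X - card I" by simp
      from less.hyps[OF this x(2)] show ?thesis using x B less.prems by auto
    next
      case False
      with card_le_rank[OF less.prems] less.prems show ?thesis by auto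
    qed
  qed
  with that show thesis by blast
qed

lemma rank_indep: "I \<in> indep_sets M \<Longrightarrow> rank M I = card I"
  by (rule obtain_basis[of I I]) auto

lemma rank_mono: "X \<subseteq> Y \<Longrightarrow> rank M X \<le> rank M Y"
  by (rule obtain_basis[OF indep_empty empty_subsetI, of X]) (metis card_le_rank order_trans)

lemma rank_dependent_less:
  assumes "finite X" "X \<notin> indep_sets M"
  shows "rank M X < card X"
proof -
  obtain J where "J \<in> indep_sets M" "J \<subseteq> X" "card J = rank M X"
    using obtain_basis[OF indep_empty empty_subsetI] by blast
  with assms show ?thesis by (metis psubset_card_mono psubsetI)
qed

text \<open>Extend a basis of \<open>A \<inter> B\<close> to a basis \<open>J\<close> of
  \<open>A \<union> B\<close> and count \<open>J\<close> through its traces on \<open>A\<close> and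
  \<open>B\<close>, whose overlap contains the first basis.\<close>

lemma rank_submodular: "rank M (A \<union> B) + rank M (A \<inter> B) \<le> rank M A + rank M B"
proof -
  obtain I where I: "I \<in> indep_sets M" "I \<subseteq> A \<inter> B" "card I = rank M (A \<inter> B)"
    using obtain_basis[OF indep_empty empty_subsetI] by blast
  then obtain J where J: "J \<in> indep_sets M" "I \<subseteq> J" "J \<subseteq> A \<union> B" "card J = rank M (A \<union> B)"
    using obtain_basis[of I "A \<union> B"] by blast
  have fin: "finite J" using finite_indep J(1) .
  have "card (J \<inter> A) + card (J \<inter> B) = card ((J \<inter> A) \<union> (J \<inter> B)) + card ((J \<inter> A) \<inter> (J \<inter> B))"
    using fin by (intro card_Un_Int) auto
  moreover have "(J \<inter> A) \<union> (J \<inter> B) = J" using J(3) by auto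
  moreover have "card I \<le> card ((J \<inter> A) \<inter> (J \<inter> B))"
    using fin I J by (intro card_mono) auto
  moreover have "card (J \<inter> A) \<le> rank M A" "card (J \<inter> B) \<le> rank M B"
    using indep_subset[OF J(1)] by (simp_all add: card_le_rank)
  ultimately show ?thesis using I(3) J(4) by simp
qed

text \<open>By submodularity the rank gained by adding \<open>f\<close> does not decrease when the
  set shrinks, so lying outside the closure of \<open>Z\<close> turns into a rank increment for
  every subset.\<close>

lemma rank_insert_notin_cl:
  assumes "f \<in> ground M" "f \<notin> cl M Z" "X \<subseteq> Z"
  shows "rank M X + 1 \<le> rank M (insert f X)"
proof -
  have "rank M Z + 1 \<le> rank M (insert f Z)"
    using assms(1,2) rank_mono[OF subset_insertI, of Z f] unfolding cl_def by simp
  moreover have "rank M (insert f X \<union> Z) + rank M (insert f X \<inter> Z) \<le> rank M (insert f X) + rank M Z"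
    by (rule rank_submodular)
  moreover have "insert f X \<union> Z = insert f Z" using assms(3) by auto
  moreover have "rank M X \<le> rank M (insert f X \<inter> Z)" using assms(3) by (intro rank_mono) auto
  ultimately show ?thesis by simp
qed

text \<open>If \<open>C\<close> met both sides, both traces would be independent. Submodularity,
  applied once with \<open>Y\<close> and once with \<open>S\<close>, then turns r(S) + r(Y) \<le>
  r(S \<union> Y) into |C| \<le> r(C), which fails for a dependent set.\<close>

lemma circuit_subset_skew:
  assumes C: "circuit M C" "C \<subseteq> S \<union> Y" and skew: "rank M S + rank M Y \<le> rank M (S \<union> Y)"
    and disj: "S \<inter> Y = {}"
  shows "C \<subseteq> S \<or> C \<subseteq> Y"
proof (rule ccontr)
  assume "\<not> ?thesis"
  then have "C \<inter> S \<subset> C" "C \<inter> Y \<subset> C" by auto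
  then have "C \<inter> S \<in> indep_sets M" "C \<inter> Y \<in> indep_sets M" using C(1) unfolding circuit_def by blast+
  then have r: "rank M (C \<inter> S) = card (C \<inter> S)" "rank M (C \<inter> Y) = card (C \<inter> Y)"
    by (simp_all add: rank_indep)
  have fin: "finite C" using C(1) finite_ground finite_subset unfolding circuit_def by blast
  have "rank M (S \<union> (C \<inter> Y) \<union> Y) + rank M ((S \<union> (C \<inter> Y)) \<inter> Y) \<le> rank M (S \<union> (C \<inter> Y)) + rank M Y"
    by (rule rank_submodular)
  moreover have "S \<union> (C \<inter> Y) \<union> Y = S \<union> Y" "(S \<union> (C \<inter> Y)) \<inter> Y = C \<inter> Y" using disj by auto
  moreover have "rank M (S \<union> C) + rank M (S \<inter> C) \<le> rank M S + rank M C"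
    by (rule rank_submodular)
  moreover have "S \<union> C = S \<union> (C \<inter> Y)" "S \<inter> C = C \<inter> S" using C(2) by auto
  moreover have "rank M C < card C"
    using C(1) fin rank_dependent_less unfolding circuit_def by blast
  moreover have "card C = card (C \<inter> S) + card (C \<inter> Y)"
    using C(2) disj fin by (subst card_Un_disjoint[symmetric]) (auto intro!: arg_cong[where f = card])
  ultimately show False using skew r by simp
qed

lemma dependent_obtains_circuit:
  assumes "X \<subseteq> ground M" "X \<notin> indep_sets M"
  obtains C where "circuit M C" "C \<subseteq> X"
proof -
  have "finite X" using assms(1) finite_ground finite_subset by blast
  then have "\<exists>C \<subseteq> X. circuit M C" using assms
  proof (induction X rule: finite_psubset_induct)
    case (psubset X)
    show ?case
    proof (cases "\<exists>D. D \<subset> X \<and> D \<notin> indep_sets M")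
      case True
      with psubset show ?thesis by (meson order_trans psubset_imp_subset)
    next
      case False
      with psubset.prems have "circuit M X" unfolding circuit_def by auto
      then show ?thesis by blast
    qed
  qed
  with that show thesis by blast
qed

end

section \<open>Growing vertex sets along edges\<close>

text \<open>Every step adds exactly one new vertex, through a non-loop edge at it. Rule induction
  can therefore compare ranks and edge counts with the number of vertices, which plain reachability
  does not track.\<close>

inductive grows :: "('v, 'e) pre_multigraph \<Rightarrow> 'v set \<Rightarrow> 'v set \<Rightarrow> bool" for G U where
  base: "grows G U U"
| step: "\<lbrakk>grows G U W; f \<in> edges G; ends G f = {a, b}; a \<in> W; b \<notin> W\<rbrakk> \<Longrightarrow> grows G U (insert b W)"

definition spanned :: "('v, 'e) pre_multigraph \<Rightarrow> 'v set \<Rightarrow> 'e set" where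
  "spanned G U = {f \<in> edges G. ends G f \<subseteq> U}"

text \<open>Among sets of vertices of \<open>G\<close> these are the unions of vertex sets of
  components. A closed set grown from one vertex is the vertex set of a single component.\<close>

definition closed_in :: "('v, 'e) pre_multigraph \<Rightarrow> 'v set \<Rightarrow> bool" where
  "closed_in G W \<longleftrightarrow> (\<forall>f \<in> edges G. ends G f \<inter> W \<noteq> {} \<longrightarrow> ends G f \<subseteq> W)"

definition induced :: "('v, 'e) pre_multigraph \<Rightarrow> 'v set \<Rightarrow> ('v, 'e) pre_multigraph" where
  "induced G K = \<lparr>verts = K, edges = spanned G K, ends = ends G\<rparr>"

lemma grows_subset: "grows G U W \<Longrightarrow> U \<subseteq> W"
  by (induction rule: grows.induct) auto

lemma grows_verts:
  assumes "multigraph G" "grows G U W" "U \<subseteq> verts G"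
  shows "W \<subseteq> verts G"
  using assms(2) by (induction rule: grows.induct) (use assms in \<open>auto simp: multigraph_def\<close>)

lemma grows_trans:
  assumes "grows G V W" "grows G U V"
  shows "grows G U W"
  using assms(1) by (induction rule: grows.induct) (auto intro: grows.intros assms(2))

text \<open>Steps to a vertex already in \<open>U\<close> are skipped. This lets a growth inside a
  subgraph continue a growth of \<open>G\<close> that has reached it.\<close>

lemma grows_Un:
  assumes "grows H A B" "edges H \<subseteq> edges G" "ends H = ends G"
  shows "grows G (U \<union> A) (U \<union> B)"
  using assms(1)
proof (induction rule: grows.induct)
  case (step W f a b)
  show ?case
  proof (cases "b \<in> U")
    case True
    with step.IH show ?thesis by (simp add: insert_absorb)
  next
    case False
    with step assms have "grows G (U \<union> A) (insert b (U \<union> W))"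
      by (intro grows.step[of _ _ "U \<union> W" f a b]) auto
    then show ?thesis by simp
  qed
qed (rule grows.base)

lemmas grows_supergraph = grows_Un[where U = "{}", simplified]

lemma ends_crossing:
  assumes "multigraph G" "f \<in> edges G" "ends G f \<inter> W \<noteq> {}" "\<not> ends G f \<subseteq> W"
  obtains a b where "ends G f = {a, b}" "a \<in> W" "b \<notin> W"
proof -
  obtain a b where ab: "a \<in> ends G f" "a \<in> W" "b \<in> ends G f" "b \<notin> W" using assms by auto
  have fin: "finite (ends G f)" "card (ends G f) \<le> 2"
    using assms(1,2) finite_subset unfolding multigraph_def by fastforce+
  have "a \<noteq> b" using ab by auto
  then have "{a, b} = ends G f" using ab fin by (intro card_seteq) auto
  with ab that show thesis by metis
qed

text \<open>Only finitely many sets grow from \<open>U\<close>; an edge leaving a maximal one would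
  allow another step.\<close>

lemma obtain_closed_in:
  assumes "multigraph G" "U \<subseteq> verts G"
  obtains W where "grows G U W" "W \<subseteq> verts G" "closed_in G W"
proof -
  have fin: "finite (verts G)" using assms(1) unfolding multigraph_def by simp
  have "{W. grows G U W} \<subseteq> Pow (verts G)"
    using grows_verts[OF assms(1) _ assms(2)] by blast
  then have "finite {W. grows G U W}"
    using fin by (rule finite_subset[OF _ finite_Pow_iff[THEN iffD2]])
  then obtain W where W: "grows G U W" "\<And>W'. grows G U W' \<Longrightarrow> W \<subseteq> W' \<Longrightarrow> W' = W"
    using finite_has_maximal[of "{W. grows G U W}"] grows.base by fastforce
  have "closed_in G W"
    unfolding closed_in_def
  proof (intro ballI impI, rule ccontr)
    fix f assume "f \<in> edges G" "ends G f \<inter> W \<noteq> {}" "\<not> ends G f \<subseteq> W"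
    with ends_crossing[OF assms(1)] W(1) obtain b where "grows G U (insert b W)" "b \<notin> W"
      by (metis grows.step)
    with W(2) show False by blast
  qed
  with W(1) grows_verts[OF assms(1) W(1) assms(2)] that show thesis by blast
qed

section \<open>Connectedness and components through closed vertex sets\<close>

lemma closed_in_rtrancl:
  assumes "(x, y) \<in> (adjacency G)\<^sup>*" "closed_in G W" "x \<in> W"
  shows "y \<in> W"
  using assms by (induction rule: rtrancl_induct) (auto simp: adjacency_def closed_in_def)

lemma connected_grows:
  assumes "multigraph G" "connected G" "z \<in> verts G"
  shows "grows G {z} (verts G)"
proof -
  obtain W where W: "grows G {z} W" "W \<subseteq> verts G" "closed_in G W"
    using obtain_closed_in assms(1,3) by (metis empty_subsetI insert_subset)
  have "verts G \<subseteq> W"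
    using closed_in_rtrancl[OF _ W(3)] grows_subset[OF W(1)] assms unfolding connected_def by blast
  with W show ?thesis by (metis subset_antisym)
qed

lemma sym_adjacency: "sym (adjacency G)"
  unfolding sym_def adjacency_def by (auto simp: insert_commute)

lemma grows_connected:
  assumes "grows G {z} (verts G)"
  shows "connected G"
proof -
  have "(z, y) \<in> (adjacency G)\<^sup>*" if "grows G {z} W" "y \<in> W" for W y
    using that
  proof (induction arbitrary: y rule: grows.induct)
    case (step W f a b)
    then have "(a, b) \<in> adjacency G" unfolding adjacency_def by auto
    with step show ?case by (auto intro: rtrancl_into_rtrancl)
  qed simp
  with assms sym_rtrancl[OF sym_adjacency] show ?thesis
    unfolding connected_def using grows_subset[OF assms] by (metis empty_iff insert_subset rtrancl_trans symD)
qed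

lemma grows_induced:
  assumes "grows G {z} K"
  shows "grows (induced G K) {z} K"
proof -
  have "grows (induced G K) {z} W" if "grows G {z} W" "W \<subseteq> K" for W
    using that
  proof (induction rule: grows.induct)
    case (step W f a b)
    then show ?case
      by (intro grows.step[of _ _ W f a b]) (auto simp: induced_def spanned_def)
  qed (rule grows.base)
  with assms show ?thesis by blast
qed

text \<open>Maximality: a connected subgraph containing \<open>induced G K\<close> cannot leave the
  closed set \<open>K\<close>, so its edges all lie in \<open>spanned G K\<close>.\<close>

lemma induced_component:
  assumes G: "multigraph G" and K: "grows G {z} K" "K \<subseteq> verts G" "closed_in G K"
  shows "induced G K \<in> components G"
proof -
  have sub: "subgraph (induced G K) G"
    using G K(2) finite_subset[OF K(2)]
    unfolding subgraph_def multigraph_def induced_def spanned_def by auto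
  have "connected (induced G K)"
    using grows_connected[of "induced G K" z] grows_induced[OF K(1)] by (simp add: induced_def)
  moreover have "H' = induced G K"
    if H': "subgraph H' G" "connected H'" "subgraph (induced G K) H'" for H'
  proof -
    have K_sub: "K \<subseteq> verts H'" "spanned G K \<subseteq> edges H'"
      using H'(3) unfolding subgraph_def induced_def by auto
    have clo: "closed_in H' K"
      using H'(1) K(3) unfolding closed_in_def subgraph_def by auto
    have "z \<in> K" using grows_subset[OF K(1)] by simp
    then have "verts H' \<subseteq> K"
      using H'(2) K_sub closed_in_rtrancl[OF _ clo] unfolding connected_def by blast
    then have "verts H' = K" using K_sub by auto
    moreover have "\<forall>f \<in> edges H'. ends G f \<subseteq> verts H'"
      using H'(1) unfolding subgraph_def multigraph_def by metis
    then have "edges H' \<subseteq> spanned G K"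
      using H'(1) \<open>verts H' = K\<close> unfolding subgraph_def spanned_def by auto
    ultimately show ?thesis
      using K_sub H'(1) by (intro pre_multigraph.equality) (auto simp: induced_def subgraph_def)
  qed
  ultimately show ?thesis using sub unfolding components_def by blast
qed

text \<open>Stop the growth when it first meets \<open>Z\<close>: a step adds one vertex, so exactly
  one vertex is common. The set \<open>U\<close> plays the part of a path from \<open>v\<close> to
  \<open>Z\<close>.\<close>

lemma grows_hits_once:
  assumes "grows G {v} W" "W \<inter> Z \<noteq> {}"
  obtains U z where "grows G {v} U" "U \<inter> Z = {z}"
proof -
  have "\<exists>U z. grows G {v} U \<and> U \<inter> Z = {z}"
    using assms
  proof (induction rule: grows.induct)
    case base
    then have "{v} \<inter> Z = {v}" by auto
    then show ?case using grows.base by blast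
  next
    case (step W f a b)
    show ?case
    proof (cases "W \<inter> Z = {}")
      case True
      with step.prems have "insert b W \<inter> Z = {b}" by auto
      with grows.step[OF step.hyps] show ?thesis by blast
    qed (rule step.IH)
  qed
  with that show thesis by blast
qed

text \<open>Each new vertex brings at least one new edge, the one used by the step, so |E(U)| - |U|
  never drops. The form is additive because subtraction of naturals truncates.\<close>

lemma card_spanned_grows:
  assumes "multigraph G" "U \<subseteq> verts G" "grows G U W"
  shows "card (spanned G U) + card W \<le> card (spanned G W) + card U"
  using assms(3)
proof (induction rule: grows.induct)
  case (step W f a b)
  have fin: "finite W" "finite (edges G)"
    using grows_verts[OF assms(1) step.hyps(1) assms(2)] assms(1) finite_subset
    unfolding multigraph_def by auto
  have "insert f (spanned G W) \<subseteq> spanned G (insert b W)" "f \<notin> spanned G W"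
    using step.hyps unfolding spanned_def by auto
  moreover have "finite (spanned G (insert b W))" "finite (spanned G W)"
    using fin unfolding spanned_def by auto
  ultimately have "Suc (card (spanned G W)) \<le> card (spanned G (insert b W))"
    by (metis card_insert_disjoint card_mono)
  with step fin show ?case by simp
qed simp

section \<open>Edge-induced subgraphs and the handshake identity\<close>

lemma edge_subgraph_simps [simp]:
  "verts (edge_subgraph G X) = \<Union> (ends G ` X)" "edges (edge_subgraph G X) = X"
  "ends (edge_subgraph G X) = ends G"
  by (simp_all add: edge_subgraph_def)

lemma edge_subgraph_subgraph:
  assumes "multigraph G" "X \<subseteq> edges G"
  shows "multigraph (edge_subgraph G X)" "subgraph (edge_subgraph G X) G"
proof -
  have "finite X" "\<Union> (ends G ` X) \<subseteq> verts G" "finite (verts G)"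
    using assms finite_subset[of X] unfolding multigraph_def by (auto 0 3)
  then show "multigraph (edge_subgraph G X)"
    using assms finite_subset[of "\<Union> (ends G ` X)"] unfolding multigraph_def
    by (simp add: subset_eq) blast
  then show "subgraph (edge_subgraph G X) G"
    using assms \<open>\<Union> (ends G ` X) \<subseteq> verts G\<close> unfolding subgraph_def by simp
qed

text \<open>Double counting of incidences. The second indicator is nonzero only for loops and makes
  up for their having a single end.\<close>

lemma sum_degree:
  assumes "multigraph G"
  shows "(\<Sum>u \<in> verts G. degree G u) = 2 * card (edges G)"
proof -
  have fin: "finite (verts G)" "finite (edges G)" using assms unfolding multigraph_def by auto
  have "(\<Sum>u \<in> verts G. degree G u) =
      (\<Sum>u \<in> verts G. \<Sum>f \<in> edges G. of_bool (u \<in> ends G f) + of_bool (ends G f = {u}))"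
    using fin unfolding degree_def loops_def by (simp add: sum.distrib Int_def)
  also have "\<dots> = (\<Sum>f \<in> edges G. \<Sum>u \<in> verts G. of_bool (u \<in> ends G f) + of_bool (ends G f = {u}))"
    by (rule sum.swap)
  also have "\<dots> = (\<Sum>f \<in> edges G. 2)"
  proof (rule sum.cong[OF refl])
    fix f assume f: "f \<in> edges G"
    then have sub: "ends G f \<subseteq> verts G" and c: "card (ends G f) = 1 \<or> card (ends G f) = 2"
      using assms unfolding multigraph_def by auto
    have "(\<Sum>u \<in> verts G. of_bool (u \<in> ends G f) :: nat) = card (ends G f)"
      using fin sub by (simp add: Int_absorb1)
    moreover have "(\<Sum>u \<in> verts G. of_bool (ends G f = {u}) :: nat) = card (verts G \<inter> {u. ends G f = {u}})"
      using fin by simp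
    moreover have "card (ends G f) + card (verts G \<inter> {u. ends G f = {u}}) = 2"
      using c
    proof
      assume "card (ends G f) = 1"
      then obtain a where "ends G f = {a}" by (rule card_1_singletonE)
      moreover from this have "verts G \<inter> {u. ends G f = {u}} = {a}" using sub by auto
      ultimately show ?thesis by simp
    next
      assume "card (ends G f) = 2"
      moreover from this have "verts G \<inter> {u. ends G f = {u}} = {}" by auto
      ultimately show ?thesis by simp
    qed
    ultimately show "(\<Sum>u \<in> verts G. of_bool (u \<in> ends G f) + of_bool (ends G f = {u})) = (2::nat)"
      by (simp add: sum.distrib)
  qed
  finally show ?thesis by simp
qed

section \<open>Rank in frameworks\<close>

locale matroid_framework = matroid M for M :: "'e pre_matroid" (structure) +
  fixes G :: "('v, 'e) pre_multigraph"
  assumes framework: "framework G M"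
begin

lemma multigraph_G: "multigraph G"
  using framework unfolding framework_def by blast

lemma edges_G: "edges G = ground M"
  using framework unfolding framework_def by blast

lemma finite_vertex_set: "U \<subseteq> verts G \<Longrightarrow> finite U"
  using multigraph_G finite_subset unfolding multigraph_def by blast

text \<open>The third framework condition, read contrapositively; it is the source of the rank
  increments at growth steps.\<close>

lemma notin_cl_delete_vertex:
  assumes "f \<in> edges G" "u \<in> ends G f" "f \<notin> loops G u"
  shows "f \<notin> cl M (edges (delete_vertex G u))"
proof -
  have "u \<in> verts G" using assms multigraph_G unfolding multigraph_def by auto
  then have "cl M (edges (delete_vertex G u)) \<subseteq> edges (delete_vertex G u) \<union> loops G u"
    using framework unfolding framework_def by blast
  with assms show ?thesis unfolding delete_vertex_def by auto
qed

text \<open>The edge \<open>f\<close> of a step is a non-loop at the new vertex \<open>b\<close>,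
  while the edges spanned so far and those of \<open>Y\<close> all avoid \<open>b\<close>. So
  \<open>f\<close> lies outside the closure of E(G - b) and raises the rank.\<close>

lemma rank_spanned_grows:
  assumes "U \<subseteq> verts G" "grows G U W" "Y \<subseteq> edges G" "\<forall>f \<in> Y. ends G f \<inter> W = {}"
  shows "rank M (spanned G U \<union> Y) + card W \<le> rank M (spanned G W \<union> Y) + card U"
  using assms(2,4)
proof (induction rule: grows.induct)
  case (step W f a b)
  have fin: "finite W"
    using finite_vertex_set grows_verts[OF multigraph_G step.hyps(1) assms(1)] by blast
  have "f \<notin> loops G b" using step.hyps unfolding loops_def by auto
  then have "f \<notin> cl M (edges (delete_vertex G b))"
    using step.hyps by (intro notin_cl_delete_vertex) auto
  moreover have "spanned G W \<union> Y \<subseteq> edges (delete_vertex G b)"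
    using step assms(3) unfolding spanned_def delete_vertex_def by auto
  ultimately have "rank M (spanned G W \<union> Y) + 1 \<le> rank M (insert f (spanned G W \<union> Y))"
    using step.hyps edges_G by (intro rank_insert_notin_cl) auto
  also have "\<dots> \<le> rank M (spanned G (insert b W) \<union> Y)"
    using step.hyps by (intro rank_mono) (auto simp: spanned_def)
  finally show ?case using step fin by simp
qed simp

text \<open>The second framework condition bounds whole components only. Growing \<open>U\<close> to
  its component raises the rank at least as fast as the number of vertices, so the bound descends to
  \<open>U\<close>.\<close>

lemma rank_spanned_le:
  assumes "z \<in> verts G" "grows G {z} U"
  shows "rank M (spanned G U) \<le> card U"
proof -
  have U: "U \<subseteq> verts G" using grows_verts[OF multigraph_G assms(2)] assms(1) by simp
  obtain K where K: "grows G U K" "K \<subseteq> verts G" "closed_in G K"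
    using obtain_closed_in[OF multigraph_G U] by blast
  have "induced G K \<in> components G"
    using induced_component[OF multigraph_G grows_trans[OF K(1) assms(2)] K(2,3)] .
  then have "rank M (spanned G K) \<le> card K"
    using framework unfolding framework_def induced_def by fastforce
  with rank_spanned_grows[OF U K(1), of "{}"] show ?thesis by simp
qed

text \<open>A loop at \<open>u\<close> already counts twice. A non-loop that is the only edge of
  \<open>C\<close> at \<open>u\<close> would lie outside the closure of the rest of
  \<open>C\<close>, which is impossible in a circuit.\<close>

lemma degree_circuit:
  assumes C: "circuit M C" and u: "u \<in> \<Union> (ends G ` C)"
  shows "2 \<le> degree (edge_subgraph G C) u"
proof -
  have sub: "C \<subseteq> edges G" using C edges_G unfolding circuit_def by simp
  have fin: "finite C" using sub edges_G finite_ground finite_subset by metis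
  obtain f where f: "f \<in> C" "u \<in> ends G f" using u by auto
  show ?thesis
  proof (cases "f \<in> loops G u")
    case True
    then have "card {f} \<le> card {e \<in> C. u \<in> ends G e}" "card {f} \<le> card {e \<in> C. ends G e = {u}}"
      using f fin by (intro card_mono; auto simp: loops_def)+
    then show ?thesis unfolding degree_def loops_def by simp
  next
    case False
    have "\<exists>g \<in> C - {f}. u \<in> ends G g"
    proof (rule ccontr)
      assume "\<not> ?thesis"
      then have "C - {f} \<subseteq> edges (delete_vertex G u)" using sub unfolding delete_vertex_def by auto
      moreover have "f \<notin> cl M (edges (delete_vertex G u))"
        using notin_cl_delete_vertex f False sub by blast
      ultimately have "rank M (C - {f}) + 1 \<le> rank M (insert f (C - {f}))"
        using f sub edges_G by (intro rank_insert_notin_cl) auto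
      moreover have "rank M (C - {f}) = card (C - {f})"
        using C f unfolding circuit_def by (intro rank_indep) blast
      moreover have "rank M C < card C"
        using C fin unfolding circuit_def by (intro rank_dependent_less) auto
      ultimately show False using f fin by (simp add: insert_absorb card_Diff_singleton)
    qed
    then obtain g where "g \<in> C" "g \<noteq> f" "u \<in> ends G g" by auto
    then have "card {f, g} \<le> card {e \<in> C. u \<in> ends G e}"
      using f fin by (intro card_mono) auto
    with \<open>g \<noteq> f\<close> show ?thesis unfolding degree_def by simp
  qed
qed

text \<open>The set E(H) is independent and is spanned by the connected vertex set of
  \<open>H\<close>, so its size is a rank to which \<open>rank_spanned_le\<close> applies.\<close>

lemma indep_card_component:
  assumes I: "I \<in> indep_sets M" and H: "H \<in> components (edge_subgraph G I)"
  shows "card (edges H) \<le> card (verts H)"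
proof -
  have HI: "subgraph H (edge_subgraph G I)" and con: "connected H"
    using H unfolding components_def by auto
  have IG: "I \<subseteq> edges G" using I indep_subset_ground edges_G by simp
  have HG: "multigraph H" "edges H \<subseteq> I" "ends H = ends G" "verts H \<subseteq> verts G"
    using HI edge_subgraph_subgraph(2)[OF multigraph_G IG] unfolding subgraph_def by auto
  obtain z where z: "z \<in> verts H" using con unfolding connected_def by auto
  have "grows G {z} (verts H)"
    using grows_supergraph[OF connected_grows[OF HG(1) con z]] HG IG by auto
  then have "rank M (spanned G (verts H)) \<le> card (verts H)"
    using rank_spanned_le z HG by blast
  moreover have "edges H \<subseteq> spanned G (verts H)"
    using HG IG unfolding multigraph_def spanned_def by auto
  then have "rank M (edges H) \<le> rank M (spanned G (verts H))" by (rule rank_mono)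
  moreover have "rank M (edges H) = card (edges H)"
    using rank_indep indep_subset[OF I HG(2)] by blast
  ultimately show ?thesis by linarith
qed

text \<open>The degrees are all at least two and sum to 2|C|, which is at most twice the number of
  vertices; so none exceeds two.\<close>

lemma circuit_cycle:
  assumes C: "circuit M C" and con: "connected (edge_subgraph G C)"
    and le: "card C \<le> card (\<Union> (ends G ` C))"
  shows "cycle G (edge_subgraph G C)"
proof -
  let ?H = "edge_subgraph G C"
  have sub: "C \<subseteq> edges G" using C edges_G unfolding circuit_def by simp
  note mg = edge_subgraph_subgraph[OF multigraph_G sub]
  have fin: "finite (verts ?H)" using mg(1) unfolding multigraph_def by blast
  have ge: "2 \<le> degree ?H u" if "u \<in> verts ?H" for u
    using degree_circuit[OF C] that by simp
  have "degree ?H u = 2" if u: "u \<in> verts ?H" for u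
  proof (rule ccontr)
    assume "degree ?H u \<noteq> 2"
    with ge[OF u] have "2 < degree ?H u" by simp
    then have "(\<Sum>w \<in> verts ?H. 2) < (\<Sum>w \<in> verts ?H. degree ?H w)"
      using u fin ge by (intro sum_strict_mono_ex1) auto
    with sum_degree[OF mg(1)] le show False by simp
  qed
  with mg(2) con show ?thesis unfolding cycle_def by blast
qed

text \<open>As \<open>Y\<close> avoids \<open>v\<close>, the loop \<open>e\<close> adds one to r(Y).
  Growth thus starts from the single vertex \<open>v\<close> at rank at least r(Y) + 1 and ends at
  rank at least r(Y) + |U|, while r(E(U)) \<le> |U|.\<close>

lemma rank_spanned_skew:
  assumes v: "v \<in> verts G" and e: "e \<in> loops G v" "e \<notin> cl M (edges (delete_vertex G v))"
    and U: "grows G {v} U" and Y: "Y \<subseteq> edges G" "\<forall>f \<in> Y. ends G f \<inter> U = {}"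
  shows "rank M (spanned G U) + rank M Y \<le> rank M (spanned G U \<union> Y)"
proof -
  have "v \<in> U" using grows_subset[OF U] by simp
  then have "Y \<subseteq> edges (delete_vertex G v)"
    using Y unfolding delete_vertex_def by auto
  then have "rank M Y + 1 \<le> rank M (insert e Y)"
    using e edges_G by (intro rank_insert_notin_cl) (auto simp: loops_def)
  also have "\<dots> \<le> rank M (spanned G {v} \<union> Y)"
    using e by (intro rank_mono) (auto simp: loops_def spanned_def)
  finally show ?thesis
    using rank_spanned_grows[OF _ U Y] rank_spanned_le[OF v U] v by simp
qed

lemma circuit_connected:
  assumes conn: "matroid_connected 2 M"
    and v: "v \<in> verts G" and e: "e \<in> loops G v" "e \<notin> cl M (edges (delete_vertex G v))"
    and C: "circuit M C"
  shows "connected (edge_subgraph G C)"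
proof -
  let ?H = "edge_subgraph G C"
  have sub: "C \<subseteq> edges G" using C edges_G unfolding circuit_def by simp
  note mg = edge_subgraph_subgraph[OF multigraph_G sub]
  have finE: "finite (edges G)" using edges_G finite_ground by simp
  have nonempty: "C \<noteq> {}" using C indep_empty unfolding circuit_def by auto
  have ends_nonempty: "ends G f \<noteq> {}" if "f \<in> edges G" for f
    using that multigraph_G unfolding multigraph_def by fastforce
  \<comment> \<open>\<open>K\<close> is the vertex set of the component of \<open>v\<close>. If it
    missed G[C], then \<open>e\<close> would lie among the edges inside \<open>K\<close> and
    \<open>C\<close> among the others, and skewness would make this a 1-separation.\<close>
  obtain K where K: "grows G {v} K" "K \<subseteq> verts G" "closed_in G K"
    using obtain_closed_in[OF multigraph_G, of "{v}"] v by auto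
  have "K \<inter> verts ?H \<noteq> {}"
  proof
    assume disj: "K \<inter> verts ?H = {}"
    let ?S = "spanned G K" and ?Y = "edges G - spanned G K"
    have "\<forall>f \<in> ?Y. ends G f \<inter> K = {}" using K(3) unfolding closed_in_def spanned_def by auto
    then have "rank M ?S + rank M ?Y \<le> rank M (?S \<union> ?Y)"
      by (intro rank_spanned_skew[OF v e K(1)]) auto
    moreover have "?S \<union> ?Y = ground M" using edges_G unfolding spanned_def by auto
    moreover have "e \<in> ?S" using e grows_subset[OF K(1)] unfolding loops_def spanned_def by auto
    then have "1 \<le> card ?S"
      using finE unfolding spanned_def by (auto simp: Suc_le_eq card_gt_0_iff)
    moreover have "C \<subseteq> ?Y"
      using sub disj ends_nonempty unfolding spanned_def by fastforce
    then have "1 \<le> card ?Y"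
      using finE nonempty by (auto simp: Suc_le_eq card_gt_0_iff)
    ultimately have "separation M 1 ?S ?Y" unfolding separation_def by auto
    with conn show False unfolding matroid_connected_def by auto
  qed
  \<comment> \<open>That only one vertex is shared ensures below that edges of \<open>C\<close>
    avoiding \<open>W\<close> avoid \<open>U\<close> as well.\<close>
  then obtain U z where U: "grows G {v} U" "U \<inter> verts ?H = {z}"
    using grows_hits_once[OF K(1)] by blast
  \<comment> \<open>\<open>W\<close> is the vertex set of the component of G[C] containing
    \<open>z\<close>.\<close>
  obtain W where W: "grows ?H {z} W" "W \<subseteq> verts ?H" "closed_in ?H W"
    using obtain_closed_in[OF mg(1), of "{z}"] U(2) by blast
  have "z \<in> W" using grows_subset[OF W(1)] by simp
  have "grows G (U \<union> {z}) (U \<union> W)" using grows_Un[OF W(1), of G U] sub by simp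
  moreover have "U \<union> {z} = U" using U(2) by auto
  ultimately have UW: "grows G {v} (U \<union> W)" using grows_trans U(1) by metis
  let ?S = "spanned G (U \<union> W)" and ?Y = "C - spanned G (U \<union> W)"
  \<comment> \<open>Such an edge misses the closed set \<open>W\<close>, hence misses
    \<open>z\<close>, the only vertex at which an edge of \<open>C\<close> can meet
    \<open>U\<close>.\<close>
  have avoid: "ends G f \<inter> (U \<union> W) = {}" if "f \<in> ?Y" for f
  proof -
    have "\<not> ends G f \<subseteq> W" using that sub unfolding spanned_def by auto
    then have "ends G f \<inter> W = {}" using that W(3) unfolding closed_in_def
      by (metis DiffD1 edge_subgraph_simps(2,3))
    moreover have "ends G f \<subseteq> verts ?H" using that by auto
    then have "U \<inter> ends G f \<subseteq> {z}" using Int_mono[OF subset_refl, of "ends G f" _ U] U(2) by metis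
    ultimately show ?thesis using \<open>z \<in> W\<close> by blast
  qed
  have "?Y \<subseteq> edges G" using sub by (rule subset_trans[OF Diff_subset])
  with avoid have skew: "rank M ?S + rank M ?Y \<le> rank M (?S \<union> ?Y)"
    by (intro rank_spanned_skew[OF v e UW] ballI)
  have "C \<subseteq> ?S \<or> C \<subseteq> ?Y" by (rule circuit_subset_skew[OF C _ skew]) simp_all
  moreover have "\<exists>f \<in> C. f \<in> ?S"
  proof -
    obtain f where f: "f \<in> C" "z \<in> ends G f" using W(2) \<open>z \<in> W\<close> by auto
    then have "ends G f \<subseteq> W" using W(3) \<open>z \<in> W\<close> unfolding closed_in_def by auto
    with f sub show ?thesis unfolding spanned_def by auto
  qed
  ultimately have "C \<subseteq> ?S" by blast
  \<comment> \<open>Within G[C] the set \<open>U\<close> contributes only \<open>z\<close>, which is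
    in \<open>W\<close>; so the component on \<open>W\<close> covers all vertices of G[C].\<close>
  then have "verts ?H \<subseteq> U \<union> W" unfolding spanned_def by auto
  then have "verts ?H \<subseteq> (U \<inter> verts ?H) \<union> W" by blast
  then have "verts ?H = W" using W(2) \<open>z \<in> W\<close> unfolding U(2) by blast
  with W(1) show ?thesis using grows_connected by metis
qed

end

section \<open>Equality of the two families of sets\<close>

theorem theorem7p2:
  fixes G :: "('v, 'e) pre_multigraph" and M :: "'e pre_matroid" and e :: 'e and v :: 'v
  assumes "matroid M"
    and "matroid_connected 3 M"
    and "card (ground M) \<ge> 4"
    and "framework G M"
    and "v \<in> verts G"
    and "e \<in> loops G v"
    and "e \<notin> cl M (edges (delete_vertex G v))"
  shows "indep_sets M =
    {I. I \<subseteq> edges G \<and>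
        (\<nexists>C. subgraph C (edge_subgraph G I) \<and> balanced_cycle M G C) \<and>
        (\<forall>H \<in> components (edge_subgraph G I). card (edges H) \<le> card (verts H))}"
    (is "_ = ?R")
proof -
  interpret matroid_framework M G
    using assms(1,4) by (simp add: matroid_framework_def matroid_framework_axioms_def)
  have conn: "matroid_connected 2 M" using assms(2) unfolding matroid_connected_def by simp
  show ?thesis
  proof (intro subset_antisym subsetI)
    fix I assume I: "I \<in> indep_sets M"
    have "\<not> balanced_cycle M G C" if "subgraph C (edge_subgraph G I)" for C
      using that indep_subset[OF I, of "edges C"]
      unfolding balanced_cycle_def circuit_def subgraph_def by auto
    with I show "I \<in> ?R"
      using indep_card_component indep_subset_ground edges_G by blast
  next
    fix I assume "I \<in> ?R"
    then have I: "I \<subseteq> edges G" "\<And>C. subgraph C (edge_subgraph G I) \<Longrightarrow> \<not> balanced_cycle M G C"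
      "\<And>H. H \<in> components (edge_subgraph G I) \<Longrightarrow> card (edges H) \<le> card (verts H)" by auto
    show "I \<in> indep_sets M"
    proof (rule ccontr)
      assume "I \<notin> indep_sets M"
      then obtain C where C: "circuit M C" "C \<subseteq> I"
        using dependent_obtains_circuit I(1) edges_G by metis
      let ?H = "edge_subgraph G C" and ?J = "edge_subgraph G I"
      have CG: "C \<subseteq> edges G" using C I by auto
      note mg = edge_subgraph_subgraph[OF multigraph_G CG]
      note mgI = edge_subgraph_subgraph[OF multigraph_G I(1)]
      have con: "connected ?H" using circuit_connected[OF conn assms(5-7) C(1)] .
      have HJ: "subgraph ?H ?J"
        using mg(1) mgI(1) C(2) unfolding subgraph_def by auto
      show False
      \<comment> \<open>Since G[C] is connected, having no more edges than vertices makes it a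
        cycle, balanced because \<open>C\<close> is a circuit.\<close>
      proof (cases "card C \<le> card (verts ?H)")
        case True
        then have "balanced_cycle M G ?H"
          using circuit_cycle[OF C(1) con] C(1) unfolding balanced_cycle_def by simp
        with I(2) HJ show False by blast
      next
        case False
        \<comment> \<open>Now G[C] has more edges than vertices. Growing it inside G[I] to a full
          component preserves this surplus, against the edge bound for components of G[I].\<close>
        obtain z where z: "z \<in> verts ?H" using con unfolding connected_def by auto
        have "grows ?J {z} (verts ?H)"
          using grows_supergraph[OF connected_grows[OF mg(1) con z], of ?J] C(2) by simp
        moreover have VJ: "verts ?H \<subseteq> verts ?J" using C(2) by auto
        then obtain K where K: "grows ?J (verts ?H) K" "K \<subseteq> verts ?J" "closed_in ?J K"
          using obtain_closed_in[OF mgI(1)] by metis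
        ultimately have "induced ?J K \<in> components ?J"
          using induced_component[OF mgI(1)] grows_trans by metis
        then have "card (spanned ?J K) \<le> card K" using I(3) unfolding induced_def by fastforce
        moreover have "C \<subseteq> spanned ?J (verts ?H)" using C(2) unfolding spanned_def by auto
        then have "card C \<le> card (spanned ?J (verts ?H))"
          using mgI(1) unfolding multigraph_def spanned_def by (intro card_mono) auto
        ultimately show False
          using card_spanned_grows[OF mgI(1) VJ K(1)] False by simp
      qed
    qed
  qed
qed

end
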